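(* (Heisenberg group.) On $\mathbb R^3$ with coordinates $(x,y,z)$, let $a,\mathsf z,V,L,\Gamma_1,\Gamma_1^{z},\Gamma_2,\Gamma_2^{z,\pi},Q,P,X$ be as in the context. For every smooth $f$, $$\Gamma_2(f,f)+\Gamma_2^{z,\pi}(f,f)=\|\mathfrak{Hess}_{a,z}f\|^2+\mathfrak R(\nabla f,\nabla f),$$ where $\|\mathfrak{Hess}_{a,z}f\|^2=[X+\Lambda_1]^{\mathsf T}Q^{\mathsf T}Q[X+\Lambda_1]+[X+\Lambda_2]^{\mathsf T}P^{\mathsf T}P[X+\Lambda_2]$ with $$\Lambda_1=0\in\mathbb R^9,\qquad \Lambda_2^{\mathsf T}=(0,0,0,0,0,0,(a^{\mathsf T}\nabla)_2f,-(a^{\mathsf T}\nabla)_1f,0),$$ and $\mathfrak R(\nabla f,\nabla f)=\mathfrak R_1+\mathfrak R_2$ with $$\begin{aligned}\mathfrak R_1=&-\Gamma_1(f,f)+\tfrac12\Gamma_1^z(f,f)-(a^{\mathsf T}\nabla)_1V\,\partial_zf\,(a^{\mathsf T}\nabla)_2f+(a^{\mathsf T}\nabla)_2V\,\partial_zf\,(a^{\mathsf T}\nabla)_1f\\&+\Big[V_{xx}+\tfrac{y^2}4V_{zz}-yV_{xz}\Big]|(a^{\mathsf T}\nabla)_1f|^2+\Big[V_{yy}+\tfrac{x^2}4V_{zz}+xV_{yz}\Big]|(a^{\mathsf T}\nabla)_2f|^2\\&+2\Big[V_{xy}+\tfrac x2V_{xz}-\tfrac y2V_{yz}-\tfrac{xy}4V_{zz}\Big](a^{\mathsf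 T}\nabla)_1f\,(a^{\mathsf T}\nabla)_2f,\end{aligned}$$ $$\mathfrak R_2=\Big(V_{xz}-\tfrac y2V_{zz}\Big)(a^{\mathsf T}\nabla)_1f\,\partial_zf+\Big(V_{yz}+\tfrac x2V_{zz}\Big)(a^{\mathsf T}\nabla)_2f\,\partial_zf .$$
   Context: Coordinates $(x_1,x_2,x_3)=(x,y,z)$ on $\mathbb R^3$ (the Heisenberg group $\mathbb H^1$). $a^{\mathsf T}=\begin{pmatrix}1&0&-y/2\\0&1&x/2\end{pmatrix}$ and $\mathsf z^{\mathsf T}=(0,0,1)$. $V\in C^\infty(\mathbb R^3)$, $\pi=e^{-V}$, $b=-aa^{\mathsf T}\nabla V$. $(a^{\mathsf T}\nabla)_1f=\partial_xf-\frac y2\partial_zf$, $(a^{\mathsf T}\nabla)_2f=\partial_yf+\frac x2\partial_zf$, $(\mathsf z^{\mathsf T}\nabla)_1f=\partial_zf$. Subscripts on $V$ denote partial derivatives. $Lf=\nabla\cdot(aa^{\mathsf T}\nabla f)-\langle a\otimes\nabla a,\nabla f\rangle+\langle b,\nabla f\rangle$ with $(a\otimes\nabla a)_p=\sum_k\sum_qa_{pk}\partial_{x_q}a_{qk}$ (which vanishes here). $\Gamma_1(f,f)=|a^{\mathsf T}\nabla f|^2$, $\Gamma_1^z(f,f)=|\mathsf z^{\mathsf T}\nabla f|^2$ (extended by polarization), $\Gamma_2(f,f)=\frac12L\Gamma_1(f,f)-\Gamma_1(Lf,f)$, and $$\Gamma_2^{z,\pi}(f,f)=\tfrac12L\Gamma_1^z(f,f)-\Gamma_1^z(Lf,f)+\tfrac1\pi\nabla\cdot\big(\pi\,\mathsf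 z\mathsf z^{\mathsf T}w\big)-\tfrac1\pi\nabla\cdot\big(\pi\,aa^{\mathsf T}\tilde w\big),$$ where $w_p=\langle\nabla f,\partial_{x_p}(aa^{\mathsf T})\nabla f\rangle$, $\tilde w_p=\langle\nabla f,\partial_{x_p}(\mathsf z\mathsf z^{\mathsf T})\nabla f\rangle$, $p=1,2,3$. $X\in\mathbb R^9$ is the vectorized Hessian of $f$, $X=(f_{11},f_{12},f_{13},f_{21},f_{22},f_{23},f_{31},f_{32},f_{33})^{\mathsf T}$, and $$Q=\begin{pmatrix}1&0&-\frac y2&0&0&0&-\frac y2&0&\frac{y^2}4\\0&1&\frac x2&0&0&0&0&-\frac y2&-\frac{xy}4\\0&0&0&1&0&-\frac y2&\frac x2&0&-\frac{xy}4\\0&0&0&0&1&\frac x2&0&\frac x2&\frac{x^2}4\end{pmatrix},\qquad P=\begin{pmatrix}0&0&0&0&0&0&1&0&-\frac y2\\0&0&0&0&0&0&0&1&\frac x2\end{pmatrix}.$$ *)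

theory Defs
  imports "HOL-Analysis.Analysis"
begin

section \<open>Smooth functions and differential operators on Euclidean space\<close>

text \<open>The value of \<open>partial\<close> is meaningful only where \<open>f\<close> is differentiable; every function
  it is applied to below is differentiable when \<open>f\<close> and \<open>V\<close> are smooth.\<close>

definition partial :: "'n::finite \<Rightarrow> (real^'n \<Rightarrow> real) \<Rightarrow> real^'n \<Rightarrow> real"
  where "partial i f x = frechet_derivative f (at x) (axis i 1)"

primrec C_k :: "nat \<Rightarrow> (real^'n::finite \<Rightarrow> real) \<Rightarrow> bool"
  where
    "C_k 0 f \<longleftrightarrow> continuous_on UNIV f"
  | "C_k (Suc k) f \<longleftrightarrow> f differentiable_on UNIV \<and> (\<forall>i. C_k k (partial i f))"

definition smooth :: "(real^'n::finite \<Rightarrow> real) \<Rightarrow> bool"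
  where "smooth f \<longleftrightarrow> (\<forall>k. C_k k f)"

definition grad :: "(real^'n::finite \<Rightarrow> real) \<Rightarrow> real^'n \<Rightarrow> real^'n"
  where "grad f x = (\<chi> i. partial i f x)"

definition divergence :: "(real^'n::finite \<Rightarrow> real^'n) \<Rightarrow> real^'n \<Rightarrow> real"
  where "divergence F x = (\<Sum>i\<in>UNIV. partial i (\<lambda>u. F u $ i) x)"

definition partial_mat ::
    "'n::finite \<Rightarrow> (real^'n \<Rightarrow> real^'k^'m) \<Rightarrow> real^'n \<Rightarrow> real^'k^'m"
  where "partial_mat p M x = (\<chi> i j. partial p (\<lambda>u. M u $ i $ j) x)"

section \<open>Generator and Gamma operators\<close>

text \<open>
  Here \<open>a\<close> and \<open>\<zeta>\<close> are matrix fields with \<open>n\<close> rows; the type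
  \<^typ>\<open>real^'m^'n\<close> has rows indexed by \<open>'n\<close> and columns by \<open>'m\<close>.
\<close>

definition sq_mat :: "(real^'n::finite \<Rightarrow> real^'m::finite^'n) \<Rightarrow> real^'n \<Rightarrow> real^'n^'n"
  where "sq_mat a x = a x ** transpose (a x)"

definition hgrad ::
    "(real^'n::finite \<Rightarrow> real^'m::finite^'n) \<Rightarrow> (real^'n \<Rightarrow> real) \<Rightarrow> real^'n \<Rightarrow> real^'m"
  where "hgrad a f x = transpose (a x) *v grad f x"

definition a_tensor_grad_a :: "(real^'n::finite \<Rightarrow> real^'m::finite^'n) \<Rightarrow> real^'n \<Rightarrow> real^'n"
  where "a_tensor_grad_a a x =
    (\<chi> p. \<Sum>k\<in>UNIV. \<Sum>q\<in>UNIV. a x $ p $ k * partial q (\<lambda>u. a u $ q $ k) x)"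

definition density :: "(real^'n::finite \<Rightarrow> real) \<Rightarrow> real^'n \<Rightarrow> real"
  where "density V x = exp (- V x)"

definition drift ::
    "(real^'n::finite \<Rightarrow> real^'m::finite^'n) \<Rightarrow> (real^'n \<Rightarrow> real) \<Rightarrow> real^'n \<Rightarrow> real^'n"
  where "drift a V x = - (sq_mat a x *v grad V x)"

definition L_op ::
    "(real^'n::finite \<Rightarrow> real^'m::finite^'n) \<Rightarrow> (real^'n \<Rightarrow> real) \<Rightarrow>
      (real^'n \<Rightarrow> real) \<Rightarrow> real^'n \<Rightarrow> real"
  where "L_op a V f x =
      divergence (\<lambda>u. sq_mat a u *v grad f u) x
      - a_tensor_grad_a a x \<bullet> grad f x
      + drift a V x \<bullet> grad f x"

text \<open>The polarized form of \<open>\<Gamma>\<^sub>1\<close>; \<open>\<Gamma>\<^sub>1\<^sup>z\<close> is the instance with \<open>\<zeta>\<close> in place of \<open>a\<close>.\<close>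

definition Gamma1 ::
    "(real^'n::finite \<Rightarrow> real^'m::finite^'n) \<Rightarrow> (real^'n \<Rightarrow> real) \<Rightarrow>
      (real^'n \<Rightarrow> real) \<Rightarrow> real^'n \<Rightarrow> real"
  where "Gamma1 a f g x = hgrad a f x \<bullet> hgrad a g x"

definition Gamma2 ::
    "(real^'n::finite \<Rightarrow> real^'m::finite^'n) \<Rightarrow> (real^'n \<Rightarrow> real) \<Rightarrow>
      (real^'n \<Rightarrow> real) \<Rightarrow> real^'n \<Rightarrow> real"
  where "Gamma2 a V f x =
    1/2 * L_op a V (Gamma1 a f f) x - Gamma1 a (L_op a V f) f x"

text \<open>\<open>quad_deriv a f\<close> is the field \<open>w\<close> and \<open>quad_deriv \<zeta> f\<close> the field
  \<open>w\<close> with tilde entering \<open>Gamma2_z_pi\<close>.\<close>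

definition quad_deriv ::
    "(real^'n::finite \<Rightarrow> real^'m::finite^'n) \<Rightarrow> (real^'n \<Rightarrow> real) \<Rightarrow> real^'n \<Rightarrow> real^'n"
  where "quad_deriv a f x =
    (\<chi> p. grad f x \<bullet> (partial_mat p (sq_mat a) x *v grad f x))"

definition Gamma2_z_pi ::
    "(real^'n::finite \<Rightarrow> real^'m::finite^'n) \<Rightarrow> (real^'n \<Rightarrow> real^'k::finite^'n) \<Rightarrow>
      (real^'n \<Rightarrow> real) \<Rightarrow> (real^'n \<Rightarrow> real) \<Rightarrow> real^'n \<Rightarrow> real"
  where "Gamma2_z_pi a \<zeta> V f x =
      1/2 * L_op a V (Gamma1 \<zeta> f f) x - Gamma1 \<zeta> (L_op a V f) f x
      + 1 / density V x *
          divergence (\<lambda>u. density V u *\<^sub>R (sq_mat \<zeta> u *v quad_deriv a f u)) x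
      - 1 / density V x *
          divergence (\<lambda>u. density V u *\<^sub>R (sq_mat a u *v quad_deriv \<zeta> f u)) x"

section \<open>The Heisenberg group\<close>

definition heis_a :: "real^3 \<Rightarrow> real^2^3"
  where "heis_a u = transpose (vector
    [vector [1, 0, - (u$2) / 2],
     vector [0, 1, u$1 / 2]])"

definition heis_z :: "real^3 \<Rightarrow> real^1^3"
  where "heis_z u = transpose (vector [vector [0, 0, 1]])"

definition partial2 :: "3 \<Rightarrow> 3 \<Rightarrow> (real^3 \<Rightarrow> real) \<Rightarrow> real^3 \<Rightarrow> real"
  where "partial2 i j f = partial i (partial j f)"

definition X_vec :: "(real^3 \<Rightarrow> real) \<Rightarrow> real^3 \<Rightarrow> real^9"
  where "X_vec f u = vector
    [partial2 1 1 f u, partial2 1 2 f u, partial2 1 3 f u,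
     partial2 2 1 f u, partial2 2 2 f u, partial2 2 3 f u,
     partial2 3 1 f u, partial2 3 2 f u, partial2 3 3 f u]"

definition Q_mat :: "real^3 \<Rightarrow> real^9^4"
  where "Q_mat u = (let x = u$1; y = u$2 in vector
    [vector [1, 0, -y/2, 0, 0, 0, -y/2, 0, y\<^sup>2/4],
     vector [0, 1, x/2, 0, 0, 0, 0, -y/2, -(x*y)/4],
     vector [0, 0, 0, 1, 0, -y/2, x/2, 0, -(x*y)/4],
     vector [0, 0, 0, 0, 1, x/2, 0, x/2, x\<^sup>2/4]])"

definition P_mat :: "real^3 \<Rightarrow> real^9^2"
  where "P_mat u = (let x = u$1; y = u$2 in vector
    [vector [0, 0, 0, 0, 0, 0, 1, 0, -y/2],
     vector [0, 0, 0, 0, 0, 0, 0, 1, x/2]])"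

definition Lambda1 :: "real^9"
  where "Lambda1 = 0"

definition Lambda2 :: "(real^3 \<Rightarrow> real) \<Rightarrow> real^3 \<Rightarrow> real^9"
  where "Lambda2 f u = vector
    [0, 0, 0, 0, 0, 0, hgrad heis_a f u $ 2, - (hgrad heis_a f u $ 1), 0]"

definition Hess_norm_sq :: "(real^3 \<Rightarrow> real) \<Rightarrow> real^3 \<Rightarrow> real"
  where "Hess_norm_sq f u =
      (X_vec f u + Lambda1) \<bullet> ((transpose (Q_mat u) ** Q_mat u) *v (X_vec f u + Lambda1))
    + (X_vec f u + Lambda2 f u) \<bullet>
        ((transpose (P_mat u) ** P_mat u) *v (X_vec f u + Lambda2 f u))"

definition R1 :: "(real^3 \<Rightarrow> real) \<Rightarrow> (real^3 \<Rightarrow> real) \<Rightarrow> real^3 \<Rightarrow> real"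
  where "R1 V f u = (let
      x = u$1; y = u$2;
      V_xx = partial2 1 1 V u; V_xy = partial2 1 2 V u; V_xz = partial2 1 3 V u;
      V_yy = partial2 2 2 V u; V_yz = partial2 2 3 V u; V_zz = partial2 3 3 V u;
      D1f = hgrad heis_a f u $ 1; D2f = hgrad heis_a f u $ 2;
      D1V = hgrad heis_a V u $ 1; D2V = hgrad heis_a V u $ 2;
      f_z = partial 3 f u
    in - Gamma1 heis_a f f u + 1/2 * Gamma1 heis_z f f u
       - D1V * f_z * D2f + D2V * f_z * D1f
       + (V_xx + y\<^sup>2/4 * V_zz - y * V_xz) * \<bar>D1f\<bar>\<^sup>2
       + (V_yy + x\<^sup>2/4 * V_zz + x * V_yz) * \<bar>D2f\<bar>\<^sup>2
       + 2 * (V_xy + x/2 * V_xz - y/2 * V_yz - x*y/4 * V_zz) * D1f * D2f)"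

definition R2 :: "(real^3 \<Rightarrow> real) \<Rightarrow> (real^3 \<Rightarrow> real) \<Rightarrow> real^3 \<Rightarrow> real"
  where "R2 V f u = (let
      x = u$1; y = u$2;
      V_xz = partial2 1 3 V u; V_yz = partial2 2 3 V u; V_zz = partial2 3 3 V u;
      D1f = hgrad heis_a f u $ 1; D2f = hgrad heis_a f u $ 2;
      f_z = partial 3 f u
    in (V_xz - y/2 * V_zz) * D1f * f_z + (V_yz + x/2 * V_zz) * D2f * f_z)"

definition R_tensor :: "(real^3 \<Rightarrow> real) \<Rightarrow> (real^3 \<Rightarrow> real) \<Rightarrow> real^3 \<Rightarrow> real"
  where "R_tensor V f u = R1 V f u + R2 V f u"

end

theory Submission
  imports Defs
begin

text \<open>
  In the left-invariant frame \<open>X = \<partial>\<^sub>x - (y/2) \<partial>\<^sub>z\<close>, \<open>Y = \<partial>\<^sub>y + (x/2) \<partial>\<^sub>z\<close>, \<open>Z = \<partial>\<^sub>z\<close> the generator is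
  \<open>L = X\<^sup>2 + Y\<^sup>2 - (XV) X - (YV) Y\<close>, and the only nontrivial bracket is \<open>[X, Y] = Z\<close>. Since \<open>L\<close> is a
  diffusion, each Gamma operator is a sum of squares of second derivatives plus the commutators
  of \<open>L\<close> with \<open>X\<close>, \<open>Y\<close> and \<open>Z\<close>. Both divergence corrections vanish because \<open>aa\<^sup>T\<close> does not depend
  on \<open>z\<close> and \<open>zz\<^sup>T\<close> is constant. The terms \<open>2 Yf XZf - 2 Xf YZf\<close> produced by \<open>[X, Y] = Z\<close> complete
  the squares \<open>(XZf + Yf)\<^sup>2 + (YZf - Xf)\<^sup>2\<close> at the cost of \<open>-\<Gamma>\<^sub>1\<close>, and symmetrizing \<open>XYf = S + Zf/2\<close>,
  \<open>YXf = S - Zf/2\<close> gives the remainder \<open>\<Gamma>\<^sub>1\<^sup>z/2\<close>.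
\<close>

section \<open>Calculus of partial derivatives\<close>

text \<open>\<open>frechet_derivative\<close> is a choice; uniqueness of the derivative at a point
  identifies it with any derivative exhibited.\<close>

lemma has_derivative_partial:
  assumes "(f has_derivative f') (at x)"
  shows "partial i f x = f' (axis i 1)"
  using frechet_derivative_at[OF assms] by (simp add: partial_def)

lemma differentiable_on_UNIV_at:
  "f differentiable_on UNIV \<Longrightarrow> f differentiable at x"
  by (simp add: differentiable_on_def)

lemma has_derivative_frechet:
  "f differentiable_on UNIV \<Longrightarrow> (f has_derivative frechet_derivative f (at x)) (at x)"
  using differentiable_on_UNIV_at frechet_derivative_works by blast

lemma partial_const: "partial i (\<lambda>u. c) = (\<lambda>u. 0)"
  by (rule ext) (simp add: partial_def)

lemma partial_coord:
  fixes i j :: "'n::finite"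
  shows "partial i (\<lambda>u. u $ j) = (\<lambda>u. if i = j then 1 else 0)"
proof
  fix x :: "real^'n"
  have "((\<lambda>u. u $ j) has_derivative (\<lambda>u. u $ j)) (at x)"
    by (rule bounded_linear_imp_has_derivative) (rule bounded_linear_vec_nth)
  from has_derivative_partial[OF this, of i]
  show "partial i (\<lambda>u. u $ j) x = (if i = j then 1 else 0)"
    by (simp add: axis_def eq_commute)
qed

lemma partial_add:
  assumes "f differentiable_on UNIV" "g differentiable_on UNIV"
  shows "partial i (\<lambda>u. f u + g u) = (\<lambda>u. partial i f u + partial i g u)"
  using has_derivative_partial[OF has_derivative_add[OF assms[THEN has_derivative_frechet]]]
  by (intro ext) (simp add: partial_def)

lemma partial_mult:
  assumes "f differentiable_on UNIV" "g differentiable_on UNIV"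
  shows "partial i (\<lambda>u. f u * g u) = (\<lambda>u. partial i f u * g u + f u * partial i g u)"
  using has_derivative_partial[OF has_derivative_mult[OF assms[THEN has_derivative_frechet]]]
  by (intro ext) (simp add: partial_def)

section \<open>Closure properties of smooth functions\<close>

lemma C_k_Suc_imp: "C_k (Suc k) f \<Longrightarrow> C_k k f"
  by (induction k arbitrary: f) (auto intro: differentiable_imp_continuous_on)

lemma C_k_const: "C_k k (\<lambda>u. c)"
  by (induction k arbitrary: c) (auto simp: partial_const)

lemma C_k_coord: "C_k k (\<lambda>u. u $ j)"
proof (cases k)
  case 0
  then show ?thesis by (auto intro: continuous_intros)
next
  case (Suc m)
  have "(\<lambda>u::real^'a. u $ j) differentiable_on UNIV"
    by (intro linear_imp_differentiable_on bounded_linear.linear bounded_linear_vec_nth)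
  with Suc show ?thesis by (simp add: partial_coord C_k_const)
qed

lemma C_k_add: "C_k k f \<Longrightarrow> C_k k g \<Longrightarrow> C_k k (\<lambda>u. f u + g u)"
  by (induction k arbitrary: f g) (auto simp: partial_add intro: continuous_on_add)

lemma C_k_mult: "C_k k f \<Longrightarrow> C_k k g \<Longrightarrow> C_k k (\<lambda>u. f u * g u)"
proof (induction k arbitrary: f g)
  case 0
  then show ?case by (auto intro: continuous_on_mult)
next
  case (Suc k)
  \<comment> \<open>The product rule leaves \<open>f\<close> and \<open>g\<close> as
    undifferentiated factors, so they too must be available at level \<open>k\<close>.\<close>
  then have "C_k k f" "C_k k g" by (blast intro: C_k_Suc_imp)+
  with Suc show ?case by (auto simp: partial_mult intro!: C_k_add)
qed

lemma smooth_differentiable: "smooth f \<Longrightarrow> f differentiable_on UNIV"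
  unfolding smooth_def by (metis C_k.simps(2))

lemma smooth_continuous: "smooth f \<Longrightarrow> continuous_on UNIV f"
  by (simp add: smooth_differentiable differentiable_imp_continuous_on)

lemma smooth_partial [simp]: "smooth f \<Longrightarrow> smooth (partial i f)"
  unfolding smooth_def by (metis C_k.simps(2))

lemma smooth_const [simp]: "smooth (\<lambda>u. c)"
  by (simp add: smooth_def C_k_const)

lemma smooth_coord [simp]: "smooth (\<lambda>u. u $ j)"
  by (simp add: smooth_def C_k_coord)

lemma smooth_add [simp]: "smooth f \<Longrightarrow> smooth g \<Longrightarrow> smooth (\<lambda>u. f u + g u)"
  by (simp add: smooth_def C_k_add)

lemma smooth_mult [simp]: "smooth f \<Longrightarrow> smooth g \<Longrightarrow> smooth (\<lambda>u. f u * g u)"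
  by (simp add: smooth_def C_k_mult)

lemma smooth_minus [simp]: "smooth f \<Longrightarrow> smooth (\<lambda>u. - f u)"
  using smooth_mult[OF smooth_const[of "-1"]] by simp

lemma smooth_diff [simp]: "smooth f \<Longrightarrow> smooth g \<Longrightarrow> smooth (\<lambda>u. f u - g u)"
  using smooth_add[OF _ smooth_minus] by simp

lemma smooth_divide [simp]: "smooth f \<Longrightarrow> smooth (\<lambda>u. f u / c)"
  using smooth_mult[OF _ smooth_const[of "1 / c"]] by simp

text \<open>The closure rules above discharge the smoothness conditions. Being equations between
  functions, this rule and its companions also rewrite under an outer derivative.\<close>

lemma smooth_partial_add:
  "smooth f \<Longrightarrow> smooth g \<Longrightarrow> partial i (\<lambda>u. f u + g u) = (\<lambda>u. partial i f u + partial i g u)"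
  by (simp add: partial_add smooth_differentiable)

lemma smooth_partial_mult:
  "smooth f \<Longrightarrow> smooth g \<Longrightarrow>
    partial i (\<lambda>u. f u * g u) = (\<lambda>u. partial i f u * g u + f u * partial i g u)"
  by (simp add: partial_mult smooth_differentiable)

lemma smooth_partial_minus: "smooth f \<Longrightarrow> partial i (\<lambda>u. - f u) = (\<lambda>u. - partial i f u)"
  using smooth_partial_mult[OF smooth_const[of "-1"]] by (simp add: partial_const)

lemma smooth_partial_diff:
  "smooth f \<Longrightarrow> smooth g \<Longrightarrow> partial i (\<lambda>u. f u - g u) = (\<lambda>u. partial i f u - partial i g u)"
  using smooth_partial_add[of f "\<lambda>u. - g u"] by (simp add: smooth_partial_minus)

lemma smooth_partial_divide: "smooth f \<Longrightarrow> partial i (\<lambda>u. f u / c) = (\<lambda>u. partial i f u / c)"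
  using smooth_partial_mult[OF _ smooth_const[of "1 / c"]] by (simp add: partial_const)

lemmas smooth_partial_simps = partial_const partial_coord smooth_partial_add smooth_partial_mult
  smooth_partial_minus smooth_partial_diff smooth_partial_divide

section \<open>Symmetry of second partial derivatives\<close>

lemma partial_along_line:
  assumes "f differentiable_on UNIV"
  shows "((\<lambda>t. f (x + t *\<^sub>R axis i 1)) has_real_derivative partial i f (x + t *\<^sub>R axis i 1)) (at t)"
proof -
  let ?y = "x + t *\<^sub>R axis i 1" and ?D = "frechet_derivative f (at (x + t *\<^sub>R axis i 1))"
  have D: "(f has_derivative ?D) (at ?y)"
    by (rule has_derivative_frechet[OF assms])
  have line: "((\<lambda>t. x + t *\<^sub>R axis i 1) has_derivative (\<lambda>h. h *\<^sub>R axis i 1)) (at t)"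
    by (auto intro!: derivative_eq_intros)
  have "((\<lambda>t. f (x + t *\<^sub>R axis i 1)) has_derivative (\<lambda>h. ?D (h *\<^sub>R axis i 1))) (at t)"
    using diff_chain_at[OF line D] by (simp add: o_def)
  moreover have "?D (h *\<^sub>R axis i 1) = partial i f ?y * h" for h
    using linear_scale[OF has_derivative_linear[OF D]] by (simp add: partial_def)
  ultimately show ?thesis
    by (simp add: has_field_derivative_def)
qed

text \<open>The second difference is symmetric in \<open>i\<close> and \<open>j\<close>, which yields the symmetry of second
  partial derivatives below.\<close>

lemma second_difference_mvt:
  fixes f :: "real^'n::finite \<Rightarrow> real"
  assumes f: "f differentiable_on UNIV" and fi: "partial i f differentiable_on UNIV" and h: "0 < h"
  obtains s t where "0 < s" "s < h" "0 < t" "t < h"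
    "f (x + h *\<^sub>R axis i 1 + h *\<^sub>R axis j 1) - f (x + h *\<^sub>R axis i 1) - f (x + h *\<^sub>R axis j 1) + f x
      = h * h * partial j (partial i f) (x + s *\<^sub>R axis i 1 + t *\<^sub>R axis j 1)"
proof -
  \<comment> \<open>The second difference is \<open>?p h - ?p 0\<close>, where \<open>?p\<close> is
    the increment of \<open>f\<close> in direction \<open>j\<close>. The mean value theorem is
    applied first along \<open>i\<close> to \<open>?p\<close>, then along \<open>j\<close> to
    \<open>partial i f\<close>.\<close>
  let ?p = "\<lambda>s. f (x + h *\<^sub>R axis j 1 + s *\<^sub>R axis i 1) - f (x + s *\<^sub>R axis i 1)"
  let ?p' = "\<lambda>s. partial i f (x + h *\<^sub>R axis j 1 + s *\<^sub>R axis i 1) - partial i f (x + s *\<^sub>R axis i 1)"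
  have "\<exists>s. 0 < s \<and> s < h \<and> ?p h - ?p 0 = (h - 0) * ?p' s"
    by (rule MVT2[OF h]) (intro DERIV_diff partial_along_line f)
  then obtain s where s: "0 < s" "s < h" "?p h - ?p 0 = h * ?p' s"
    by auto
  let ?q = "\<lambda>t. partial i f (x + s *\<^sub>R axis i 1 + t *\<^sub>R axis j 1)"
  have "\<exists>t. 0 < t \<and> t < h \<and> ?q h - ?q 0
      = (h - 0) * partial j (partial i f) (x + s *\<^sub>R axis i 1 + t *\<^sub>R axis j 1)"
    by (rule MVT2[OF h]) (intro partial_along_line fi)
  then obtain t where t: "0 < t" "t < h" "?q h - ?q 0
      = h * partial j (partial i f) (x + s *\<^sub>R axis i 1 + t *\<^sub>R axis j 1)"
    by auto
  have "?p' s = ?q h - ?q 0"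
    by (simp add: add_ac)
  then have "?p h - ?p 0 = h * h * partial j (partial i f) (x + s *\<^sub>R axis i 1 + t *\<^sub>R axis j 1)"
    using s(3) t(3) by simp
  then have "f (x + h *\<^sub>R axis i 1 + h *\<^sub>R axis j 1) - f (x + h *\<^sub>R axis i 1) - f (x + h *\<^sub>R axis j 1) + f x
      = h * h * partial j (partial i f) (x + s *\<^sub>R axis i 1 + t *\<^sub>R axis j 1)"
    by (simp add: add_ac)
  with s(1,2) t(1,2) show thesis
    by (rule that)
qed

text \<open>Divided by \<open>h * h\<close>, the second difference is a mixed derivative at a point
  that tends to \<open>x\<close> with \<open>h\<close>. Continuity gives the limit, and the two
  orders share the same difference quotient.\<close>

lemma partial_commute:
  fixes f :: "real^'n::finite \<Rightarrow> real"
  assumes f: "smooth f"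
  shows "partial i (partial j f) = partial j (partial i f)"
proof
  fix x
  define h :: "nat \<Rightarrow> real" where "h n = 1 / (real n + 1)" for n
  have h0: "0 < h n" for n
    by (simp add: h_def)
  have h_lim: "h \<longlonglongrightarrow> 0"
    unfolding h_def using LIMSEQ_inverse_real_of_nat by (simp add: inverse_eq_divide add.commute)
  define D where "D i j n = f (x + h n *\<^sub>R axis i 1 + h n *\<^sub>R axis j 1) - f (x + h n *\<^sub>R axis i 1)
      - f (x + h n *\<^sub>R axis j 1) + f x" for i j n
  have lim: "(\<lambda>n. D i j n / (h n * h n)) \<longlonglongrightarrow> partial j (partial i f) x" for i j
  proof -
    have "\<exists>s t. 0 < s \<and> s < h n \<and> 0 < t \<and> t < h n \<and>
        D i j n = h n * h n * partial j (partial i f) (x + s *\<^sub>R axis i 1 + t *\<^sub>R axis j 1)" for n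
      unfolding D_def
      by (rule second_difference_mvt[OF _ _ h0, of f i n x j])
        (use f in \<open>auto intro: smooth_differentiable\<close>)
    then obtain s t where st: "\<And>n. 0 < s n" "\<And>n. s n < h n" "\<And>n. 0 < t n" "\<And>n. t n < h n"
      and D: "\<And>n. D i j n
        = h n * h n * partial j (partial i f) (x + s n *\<^sub>R axis i 1 + t n *\<^sub>R axis j 1)"
      by metis
    have "s \<longlonglongrightarrow> 0"
      by (rule tendsto_sandwich[OF _ _ tendsto_const h_lim])
        (intro always_eventually allI less_imp_le st)+
    moreover have "t \<longlonglongrightarrow> 0"
      by (rule tendsto_sandwich[OF _ _ tendsto_const h_lim])
        (intro always_eventually allI less_imp_le st)+
    ultimately have "(\<lambda>n. x + s n *\<^sub>R axis i 1 + t n *\<^sub>R axis j 1) \<longlonglongrightarrow> x + 0 *\<^sub>R axis i 1 + 0 *\<^sub>R axis j 1"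
      by (intro tendsto_intros)
    then have "(\<lambda>n. x + s n *\<^sub>R axis i 1 + t n *\<^sub>R axis j 1) \<longlonglongrightarrow> x"
      by simp
    moreover have "isCont (partial j (partial i f)) x"
      using smooth_continuous[of "partial j (partial i f)"] f
      by (simp add: continuous_on_eq_continuous_at)
    ultimately have "(\<lambda>n. partial j (partial i f) (x + s n *\<^sub>R axis i 1 + t n *\<^sub>R axis j 1))
        \<longlonglongrightarrow> partial j (partial i f) x"
      by (rule isCont_tendsto_compose[rotated])
    moreover have "D i j n / (h n * h n)
        = partial j (partial i f) (x + s n *\<^sub>R axis i 1 + t n *\<^sub>R axis j 1)" for n
      using D[of n] h0[of n] by simp
    ultimately show ?thesis
      by simp
  qed
  have "D j i n = D i j n" for n
    by (simp add: D_def add_ac)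
  with lim[of i j] lim[of j i] show "partial i (partial j f) x = partial j (partial i f) x"
    by (metis (no_types, lifting) LIMSEQ_unique ext)
qed

section \<open>The left-invariant frame of the Heisenberg group\<close>

definition heis_X :: "(real^3 \<Rightarrow> real) \<Rightarrow> real^3 \<Rightarrow> real"
  where "heis_X f = (\<lambda>u. partial 1 f u - u$2 / 2 * partial 3 f u)"

definition heis_Y :: "(real^3 \<Rightarrow> real) \<Rightarrow> real^3 \<Rightarrow> real"
  where "heis_Y f = (\<lambda>u. partial 2 f u + u$1 / 2 * partial 3 f u)"

lemma smooth_heis [simp]:
  assumes "smooth f"
  shows "smooth (heis_X f)" "smooth (heis_Y f)"
  using assms by (simp_all add: heis_X_def heis_Y_def)

lemma heis_const: "heis_X (\<lambda>u. c) = (\<lambda>u. 0)" "heis_Y (\<lambda>u. c) = (\<lambda>u. 0)"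
  by (simp_all add: heis_X_def heis_Y_def partial_const)

lemma heis_add:
  assumes "smooth f" "smooth g"
  shows "heis_X (\<lambda>u. f u + g u) = (\<lambda>u. heis_X f u + heis_X g u)"
    and "heis_Y (\<lambda>u. f u + g u) = (\<lambda>u. heis_Y f u + heis_Y g u)"
  using assms by (simp_all add: heis_X_def heis_Y_def smooth_partial_simps algebra_simps)

lemma heis_diff:
  assumes "smooth f" "smooth g"
  shows "heis_X (\<lambda>u. f u - g u) = (\<lambda>u. heis_X f u - heis_X g u)"
    and "heis_Y (\<lambda>u. f u - g u) = (\<lambda>u. heis_Y f u - heis_Y g u)"
  using assms by (simp_all add: heis_X_def heis_Y_def smooth_partial_simps algebra_simps)

lemma heis_mult:
  assumes "smooth f" "smooth g"
  shows "heis_X (\<lambda>u. f u * g u) = (\<lambda>u. heis_X f u * g u + f u * heis_X g u)"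
    and "heis_Y (\<lambda>u. f u * g u) = (\<lambda>u. heis_Y f u * g u + f u * heis_Y g u)"
  using assms by (simp_all add: heis_X_def heis_Y_def smooth_partial_simps algebra_simps)

text \<open>Read from left to right, the equations move \<open>heis_X\<close> outermost and
  \<open>partial 3\<close> innermost. In this normal form the third-order terms of the Gamma
  operators cancel.\<close>

lemma heis_commutators:
  assumes "smooth f"
  shows "heis_Y (heis_X f) = (\<lambda>u. heis_X (heis_Y f) u - partial 3 f u)"
    and "partial 3 (heis_X f) = heis_X (partial 3 f)"
    and "partial 3 (heis_Y f) = heis_Y (partial 3 f)"
  using assms
  by (simp_all add: heis_X_def heis_Y_def smooth_partial_simps
      partial_commute[of f 2 1] partial_commute[of f 3 1] partial_commute[of f 3 2] field_simps)

section \<open>The operators expressed in the frame\<close>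

lemma hgrad_heis_a: "hgrad heis_a f u $ 1 = heis_X f u" "hgrad heis_a f u $ 2 = heis_Y f u"
  by (simp_all add: hgrad_def heis_a_def grad_def heis_X_def heis_Y_def
      matrix_vector_mult_def sum_3)

lemma hgrad_heis_z: "hgrad heis_z f u $ 1 = partial 3 f u"
  by (simp add: hgrad_def heis_z_def grad_def matrix_vector_mult_def sum_3)

lemma Gamma1_heis_a: "Gamma1 heis_a f g = (\<lambda>u. heis_X f u * heis_X g u + heis_Y f u * heis_Y g u)"
  by (rule ext) (simp add: Gamma1_def inner_vec_def sum_2 hgrad_heis_a)

lemma Gamma1_heis_z: "Gamma1 heis_z f g = (\<lambda>u. partial 3 f u * partial 3 g u)"
  by (rule ext) (simp add: Gamma1_def inner_vec_def hgrad_heis_z)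

text \<open>The third entry is kept in terms of the first two because \<open>a\<close> combines its
  columns with the coefficients \<open>a^T v\<close>; for \<open>v = grad f\<close> these are
  \<open>heis_X f\<close> and \<open>heis_Y f\<close>.\<close>

lemma sq_mat_heis_a_mult:
  "(sq_mat heis_a u *v v) $ 1 = v$1 - u$2 / 2 * v$3"
  "(sq_mat heis_a u *v v) $ 2 = v$2 + u$1 / 2 * v$3"
  "(sq_mat heis_a u *v v) $ 3
    = - (u$2 / 2) * (v$1 - u$2 / 2 * v$3) + u$1 / 2 * (v$2 + u$1 / 2 * v$3)"
  by (simp_all add: sq_mat_def heis_a_def matrix_matrix_mult_def matrix_vector_mult_def
      transpose_def sum_2 sum_3 field_simps)

lemma sq_mat_heis_z_mult:
  "(sq_mat heis_z u *v v) $ 1 = 0"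
  "(sq_mat heis_z u *v v) $ 2 = 0"
  "(sq_mat heis_z u *v v) $ 3 = v$3"
  by (simp_all add: sq_mat_def heis_z_def matrix_matrix_mult_def matrix_vector_mult_def
      transpose_def sum_3)

text \<open>The inner sum over \<open>q\<close> is the divergence of column \<open>k\<close> of
  \<open>heis_a\<close>, and both columns are divergence free.\<close>

lemma a_tensor_grad_heis_a: "a_tensor_grad_a heis_a u = 0"
  by (simp add: a_tensor_grad_a_def heis_a_def transpose_def vec_eq_iff forall_3 sum_2 sum_3
      smooth_partial_simps)

lemma L_op_heis:
  assumes "smooth f"
  shows "L_op heis_a V f = (\<lambda>u. heis_X (heis_X f) u + heis_Y (heis_Y f) u
    - heis_X V u * heis_X f u - heis_Y V u * heis_Y f u)"
  using assms
  by (intro ext) (simp add: L_op_def a_tensor_grad_heis_a divergence_def drift_def inner_vec_def sum_3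
      sq_mat_heis_a_mult grad_def heis_X_def heis_Y_def smooth_partial_simps, simp add: field_simps)

section \<open>Bochner's formula\<close>

text \<open>Commuting derivatives gives \<open>XXYf = YXXf + 2 XZf\<close> and
  \<open>YYXf = XYYf - 2 YZf\<close>, the source of the mixed terms. In the drift,
  \<open>[X, Y] = Z\<close> leaves the two terms with a first derivative of
  \<open>V\<close>.\<close>

lemma Gamma2_heis:
  assumes V: "smooth V" and f: "smooth f"
  shows "Gamma2 heis_a V f u =
      (heis_X (heis_X f) u)\<^sup>2 + (heis_X (heis_Y f) u)\<^sup>2
    + (heis_Y (heis_X f) u)\<^sup>2 + (heis_Y (heis_Y f) u)\<^sup>2
    + 2 * heis_Y f u * heis_X (partial 3 f) u - 2 * heis_X f u * heis_Y (partial 3 f) u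
    + heis_X (heis_X V) u * (heis_X f u)\<^sup>2 + heis_Y (heis_Y V) u * (heis_Y f u)\<^sup>2
    + (heis_X (heis_Y V) u + heis_Y (heis_X V) u) * heis_X f u * heis_Y f u
    + heis_Y V u * partial 3 f u * heis_X f u - heis_X V u * partial 3 f u * heis_Y f u"
  using V f
  by (simp add: Gamma2_def Gamma1_heis_a L_op_heis heis_const heis_add heis_diff heis_mult heis_commutators,
      simp add: field_simps power2_eq_square)

text \<open>\<open>Z\<close> commutes with \<open>X\<close> and \<open>Y\<close>, so its commutator
  with \<open>L\<close> only differentiates the drift coefficients.\<close>

lemma Gamma2_z_pi_heis:
  assumes V: "smooth V" and f: "smooth f"
  shows "Gamma2_z_pi heis_a heis_z V f u =
      (heis_X (partial 3 f) u)\<^sup>2 + (heis_Y (partial 3 f) u)\<^sup>2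
    + partial 3 f u * (heis_X (partial 3 V) u * heis_X f u + heis_Y (partial 3 V) u * heis_Y f u)"
proof -
  \<comment> \<open>Component 3 suffices, since \<open>sq_mat heis_z\<close> projects onto the third
    axis.\<close>
  have "quad_deriv heis_a f v $ 3 = 0" for v
    by (simp add: quad_deriv_def partial_mat_def sq_mat_def heis_a_def matrix_matrix_mult_def
        matrix_vector_mult_def inner_vec_def transpose_def sum_2 sum_3 smooth_partial_simps)
  then have "divergence (\<lambda>u. density V u *\<^sub>R (sq_mat heis_z u *v quad_deriv heis_a f u)) u = 0"
    by (simp add: divergence_def sum_3 sq_mat_heis_z_mult partial_const)
  moreover have "quad_deriv heis_z f v = 0" for v
    by (simp add: quad_deriv_def partial_mat_def sq_mat_def heis_z_def matrix_matrix_mult_def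
        matrix_vector_mult_def inner_vec_def transpose_def sum_3 smooth_partial_simps vec_eq_iff)
  then have "divergence (\<lambda>u. density V u *\<^sub>R (sq_mat heis_a u *v quad_deriv heis_z f u)) u = 0"
    by (simp add: divergence_def partial_const)
  ultimately show ?thesis
    using V f
    by (simp add: Gamma2_z_pi_def Gamma1_heis_z L_op_heis heis_const heis_add heis_diff heis_mult
        smooth_partial_simps heis_commutators,
        simp add: field_simps power2_eq_square)
qed

section \<open>The Hessian norm in Euclidean coordinates\<close>

lemma UNIV_9: "(UNIV :: 9 set) = {1, 2, 3, 4, 5, 6, 7, 8, 9}"
proof -
  have "x \<in> {1, 2, 3, 4, 5, 6, 7, 8, 9}" for x :: 9
  proof (induct x)
    case (of_int z)
    \<comment> \<open>The representatives run from 0 to 8, and \<open>0\<close> is the element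
      written \<open>9\<close> in this type.\<close>
    then have "z \<in> {0, 1, 2, 3, 4, 5, 6, 7, 8}" by auto
    then show ?case by auto
  qed
  then show ?thesis by auto
qed

lemma sum_9: "sum f (UNIV :: 9 set) = f 1 + f 2 + f 3 + f 4 + f 5 + f 6 + f 7 + f 8 + f 9"
  unfolding UNIV_9 by (simp add: ac_simps)

lemma vector_4:
  "(vector [a, b, c, d] :: 'a::zero^4) $ 1 = a"
  "(vector [a, b, c, d] :: 'a::zero^4) $ 2 = b"
  "(vector [a, b, c, d] :: 'a::zero^4) $ 3 = c"
  "(vector [a, b, c, d] :: 'a::zero^4) $ 4 = d"
  unfolding vector_def by simp_all

lemma vector_9:
  "(vector [a, b, c, d, e, f, g, h, i] :: 'a::zero^9) $ 1 = a"
  "(vector [a, b, c, d, e, f, g, h, i] :: 'a::zero^9) $ 2 = b"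
  "(vector [a, b, c, d, e, f, g, h, i] :: 'a::zero^9) $ 3 = c"
  "(vector [a, b, c, d, e, f, g, h, i] :: 'a::zero^9) $ 4 = d"
  "(vector [a, b, c, d, e, f, g, h, i] :: 'a::zero^9) $ 5 = e"
  "(vector [a, b, c, d, e, f, g, h, i] :: 'a::zero^9) $ 6 = f"
  "(vector [a, b, c, d, e, f, g, h, i] :: 'a::zero^9) $ 7 = g"
  "(vector [a, b, c, d, e, f, g, h, i] :: 'a::zero^9) $ 8 = h"
  "(vector [a, b, c, d, e, f, g, h, i] :: 'a::zero^9) $ 9 = i"
  unfolding vector_def by simp_all

text \<open>The term \<open>partial 3 f u / 2\<close> arises when \<open>X\<close> differentiates
  the coefficient \<open>x/2\<close> of \<open>Y\<close>. Without it, \<open>XYf\<close> becomes the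
  symmetric part \<open>(XYf + YXf)/2\<close>.\<close>

lemma heis_second_order:
  assumes "smooth f"
  shows "heis_X (heis_X f) u
      = partial2 1 1 f u + (u$2)\<^sup>2 / 4 * partial2 3 3 f u - u$2 * partial2 1 3 f u"
    and "heis_Y (heis_Y f) u
      = partial2 2 2 f u + (u$1)\<^sup>2 / 4 * partial2 3 3 f u + u$1 * partial2 2 3 f u"
    and "heis_X (heis_Y f) u = partial2 1 2 f u + u$1 / 2 * partial2 1 3 f u
      - u$2 / 2 * partial2 2 3 f u - u$1 * u$2 / 4 * partial2 3 3 f u + partial 3 f u / 2"
    and "heis_X (partial 3 f) u = partial2 1 3 f u - u$2 / 2 * partial2 3 3 f u"
    and "heis_Y (partial 3 f) u = partial2 2 3 f u + u$1 / 2 * partial2 3 3 f u"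
  using assms
  by (simp_all add: heis_X_def heis_Y_def partial2_def smooth_partial_simps
      partial_commute[of f 3 1] partial_commute[of f 3 2] field_simps power2_eq_square)

lemma inner_gram: "x \<bullet> ((transpose A ** A) *v x) = (A *v x) \<bullet> (A *v x)"
  for A :: "real^'n^'m" and x :: "real^'n"
  by (metis dot_lmul_matrix matrix_vector_mul_assoc vector_transpose_matrix)

text \<open>\<open>Q\<close> applied to \<open>X_vec\<close> lists the entries of the symmetric
  matrix \<open>a^T (Hess f) a\<close>, hence the repeated square. \<open>P\<close> applied to it
  gives \<open>XZf\<close> and \<open>YZf\<close>, which \<open>Lambda2\<close> shifts by
  \<open>Yf\<close> and \<open>-Xf\<close>.\<close>

lemma Hess_norm_sq_heis:
  assumes "smooth f"
  shows "Hess_norm_sq f u =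
      (heis_X (heis_X f) u)\<^sup>2 + (heis_X (heis_Y f) u - partial 3 f u / 2)\<^sup>2
    + (heis_X (heis_Y f) u - partial 3 f u / 2)\<^sup>2 + (heis_Y (heis_Y f) u)\<^sup>2
    + (heis_X (partial 3 f) u + heis_Y f u)\<^sup>2 + (heis_Y (partial 3 f) u - heis_X f u)\<^sup>2"
proof -
  let ?q = "Q_mat u *v X_vec f u" and ?p = "P_mat u *v (X_vec f u + Lambda2 f u)"
  have sym: "partial2 2 1 f u = partial2 1 2 f u" "partial2 3 1 f u = partial2 1 3 f u"
      "partial2 3 2 f u = partial2 2 3 f u"
    by (simp_all add: partial2_def partial_commute[OF assms, of 2 1]
        partial_commute[OF assms, of 3 1] partial_commute[OF assms, of 3 2])
  have q: "?q $ 1 = heis_X (heis_X f) u"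
      "?q $ 2 = heis_X (heis_Y f) u - partial 3 f u / 2"
      "?q $ 3 = heis_X (heis_Y f) u - partial 3 f u / 2"
      "?q $ 4 = heis_Y (heis_Y f) u"
    unfolding heis_second_order[OF assms]
    by (simp_all add: Q_mat_def X_vec_def Let_def matrix_vector_mult_def sum_9 vector_4 vector_9
        sym algebra_simps)
  have p: "?p $ 1 = heis_X (partial 3 f) u + heis_Y f u"
      "?p $ 2 = heis_Y (partial 3 f) u - heis_X f u"
    unfolding heis_second_order[OF assms]
    by (simp_all add: P_mat_def X_vec_def Lambda2_def Let_def matrix_vector_mult_def sum_9 vector_9
        sym hgrad_heis_a)
  show ?thesis
    unfolding Hess_norm_sq_def inner_gram Lambda1_def
    by (simp add: inner_vec_def sum_2 sum_4 q p power2_eq_square)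
qed

theorem proposition3p4:
  fixes V f :: "real^3 \<Rightarrow> real" and u :: "real^3"
  assumes "smooth V" and "smooth f"
  shows "Gamma2 heis_a V f u + Gamma2_z_pi heis_a heis_z V f u
    = Hess_norm_sq f u + R_tensor V f u"
proof -
  \<comment> \<open>The bracket multiplying \<open>2 Xf Yf\<close> in \<open>R1\<close> is the
    symmetric part of \<open>XYV\<close>.\<close>
  have "R1 V f u = - ((heis_X f u)\<^sup>2 + (heis_Y f u)\<^sup>2) + 1/2 * (partial 3 f u)\<^sup>2
      - heis_X V u * partial 3 f u * heis_Y f u + heis_Y V u * partial 3 f u * heis_X f u
      + heis_X (heis_X V) u * (heis_X f u)\<^sup>2 + heis_Y (heis_Y V) u * (heis_Y f u)\<^sup>2
      + 2 * (heis_X (heis_Y V) u - partial 3 V u / 2) * heis_X f u * heis_Y f u"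
    unfolding heis_second_order[OF assms(1)]
    by (simp add: R1_def Let_def hgrad_heis_a Gamma1_heis_a Gamma1_heis_z power2_eq_square)
  moreover have "R2 V f u = heis_X (partial 3 V) u * heis_X f u * partial 3 f u
      + heis_Y (partial 3 V) u * heis_Y f u * partial 3 f u"
    unfolding heis_second_order[OF assms(1)]
    by (simp add: R2_def Let_def hgrad_heis_a)
  \<comment> \<open>The term with \<open>Gamma1 heis_z\<close> comes from
    \<open>(XYf)^2 + (XYf - Zf)^2 = 2 (XYf - Zf/2)^2 + (Zf)^2 / 2\<close>.\<close>
  ultimately show ?thesis
    using assms
    by (simp add: R_tensor_def Hess_norm_sq_heis Gamma2_heis Gamma2_z_pi_heis heis_commutators
        power2_eq_square algebra_simps)
qed

end
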